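(* There exist two networks $A$ and $B$ of the same size $M$ such that $$f_A(t)<f_B(t)\qquad\text{for all } 0<t<\infty,$$ but for which there are a choice of $\Delta p$ with $$f^{A'}(t)>f^{B'}(t)\qquad\text{for all sufficiently large } t,$$ and a choice of $p_{M+1},q^{\rm in}_{M+1},q^{\rm out}_{M+1}$ with $$f^{A''}(t)>f^{B''}(t)\qquad\text{for all sufficiently large } t.$$ Here $A',B'$ are obtained from $A,B$ by adding $\Delta p\ge 0$ to the external rates of all nodes of both networks, and $A'',B''$ are obtained from $A,B$ by adding the same $(M+1)$st node to both networks.
   Context: Discrete Bass model: a network has $M$ nodes, external rates $p_j\ge 0$ and internal rates $q_{i,j}\ge 0$ ($i\ne j$; the influence of $i$ on $j$). $X_j(t)\in\{0,1\}$ is the state of node $j$ ($1$ = adopter), $X_j(0)=0$ for all $j$. The process $(X_1,\dots,X_M)$ is a continuous-time Markov chain in which adopters remain adopters forever, and each nonadopter $j$ becomes an adopter at rate $p_j+\sum_{k\ne j}q_{k,j}X_k(t)$ (one node changes at a time). The expected fraction of adopters in a network with $M$ nodes is $f(t)=\frac1M\,\mathbf{E}\big[\sum_{j=1}^M X_j(t)\big]$; $f_A=f^A$ denotes this for network $A$. (T1) $A'$ and $B'$: $p_j^{A'}=p_j^A+\Delta p$, $p_j^{B'}=p_j^B+\Delta p$, $j=1,\dots,M$, internal rates unchanged. (T2) $A''$ and $B''$: networks with $M+1$ nodes, keeping all rates among nodes $1,\dots,M$ from $A$ and $B$ respectively, with $p^{A''}_{M+1}=p^{B''}_{M+1}=p_{M+1}$,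 $q^{A''}_{i,M+1}=q^{B''}_{i,M+1}=q^{\rm in}_{M+1}$ and $q^{A''}_{M+1,i}=q^{B''}_{M+1,i}=q^{\rm out}_{M+1}$ for $i=1,\dots,M$, where $p_{M+1},q^{\rm in}_{M+1},q^{\rm out}_{M+1}\in[0,\infty)$. *)

theory Defs
  imports "HOL-Probability.Probability"
begin

text \<open>
  A (time-homogeneous) continuous-time Markov chain on a finite state set \<open>E\<close> with off-diagonal
  transition rates \<open>r\<close>, in terms of its finite-dimensional distributions: \<open>P h x\<close> is the law of the
  state a time \<open>h\<close> after the chain was in state \<open>x\<close>. No sample-path regularity is
  asked for, since the expectations below depend on the distributions at fixed times only.
\<close>

definition ctmc ::
  "'w measure \<Rightarrow> 's set \<Rightarrow> ('s \<Rightarrow> 's \<Rightarrow> real) \<Rightarrow> (real \<Rightarrow> 'w \<Rightarrow> 's) \<Rightarrow> bool" where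
  "ctmc \<Omega> E r Y \<longleftrightarrow>
     prob_space \<Omega> \<and> finite E \<and> (\<forall>t\<ge>0. Y t \<in> measurable \<Omega> (count_space E)) \<and>
     (\<exists>P :: real \<Rightarrow> 's \<Rightarrow> 's pmf.
        (\<forall>h>0. \<forall>x\<in>E. set_pmf (P h x) \<subseteq> E) \<and>
        (\<forall>x\<in>E. \<forall>y\<in>E. x \<noteq> y \<longrightarrow> ((\<lambda>h. pmf (P h x) y / h) \<longlongrightarrow> r x y) (at_right 0)) \<and>
        (\<forall>n \<tau> x. 0 \<le> \<tau> 0 \<and> (\<forall>i\<le>n. \<tau> i < \<tau> (Suc i)) \<and> (\<forall>i\<le>Suc n. x i \<in> E) \<and>
            \<P>(\<omega> in \<Omega>. \<forall>i\<le>n. Y (\<tau> i) \<omega> = x i) > 0 \<longrightarrow>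
            \<P>(\<omega> in \<Omega>. Y (\<tau> (Suc n)) \<omega> = x (Suc n) \<bar> \<forall>i\<le>n. Y (\<tau> i) \<omega> = x i)
              = pmf (P (\<tau> (Suc n) - \<tau> n) (x n)) (x (Suc n))))"

text \<open>
  The nodes are \<open>1, \<dots>, num_nodes\<close>; \<open>int_rate N i j\<close> is the influence of \<open>i\<close> on \<open>j\<close>. Rates
  outside this range and on the diagonal of \<open>int_rate\<close> are never used.
\<close>

record network =
  num_nodes :: nat
  ext_rate :: "nat \<Rightarrow> real"
  int_rate :: "nat \<Rightarrow> nat \<Rightarrow> real"

definition nodes :: "network \<Rightarrow> nat set" where
  "nodes N = {1..num_nodes N}"

definition valid_network :: "network \<Rightarrow> bool" where
  "valid_network N \<longleftrightarrow> num_nodes N \<ge> 1 \<and> (\<forall>j\<in>nodes N. 0 \<le> ext_rate N j) \<and>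
     (\<forall>i\<in>nodes N. \<forall>j\<in>nodes N. i \<noteq> j \<longrightarrow> 0 \<le> int_rate N i j)"

text \<open>
  A state \<open>(X\<^sub>1, \<dots>, X\<^sub>M) \<in> {0,1}\<^sup>M\<close> is represented by its set \<open>S\<close> of adopters.
\<close>

definition adoption_rate :: "network \<Rightarrow> nat \<Rightarrow> nat set \<Rightarrow> real" where
  "adoption_rate N j S = ext_rate N j + (\<Sum>k\<in>nodes N - {j}. int_rate N k j * of_bool (k \<in> S))"

text \<open>
  At most one summand is nonzero. Every transition that removes an adopter or changes
  several nodes at once has rate \<open>0\<close>.
\<close>

definition transition_rate :: "network \<Rightarrow> nat set \<Rightarrow> nat set \<Rightarrow> real" where
  "transition_rate N S T =
     (\<Sum>j\<in>nodes N - S. if T = insert j S then adoption_rate N j S else 0)"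

definition bass_process :: "network \<Rightarrow> 'w measure \<Rightarrow> (real \<Rightarrow> 'w \<Rightarrow> nat set) \<Rightarrow> bool" where
  "bass_process N \<Omega> Y \<longleftrightarrow>
     ctmc \<Omega> (Pow (nodes N)) (transition_rate N) Y \<and> (AE \<omega> in \<Omega>. Y 0 \<omega> = {})"

text \<open>
  The Bass process of a network is realised as the coordinate process on path space. Its
  finite-dimensional distributions are determined by the network, so the choice of the
  measure does not affect the expected fraction of adopters.
\<close>

definition bass_measure :: "network \<Rightarrow> (real \<Rightarrow> nat set) measure" where
  "bass_measure N = (SOME \<Omega>. bass_process N \<Omega> (\<lambda>t \<omega>. \<omega> t))"

definition X :: "nat \<Rightarrow> real \<Rightarrow> (real \<Rightarrow> nat set) \<Rightarrow> real" where
  "X j t \<omega> = of_bool (j \<in> \<omega> t)"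

definition adopter_fraction :: "network \<Rightarrow> real \<Rightarrow> real" where
  "adopter_fraction N t =
     1 / real (num_nodes N) * (\<integral>\<omega>. (\<Sum>j\<in>nodes N. X j t \<omega>) \<partial>bass_measure N)"

definition raise_external :: "real \<Rightarrow> network \<Rightarrow> network" where
  "raise_external \<Delta>p N = N\<lparr>ext_rate := (\<lambda>j. ext_rate N j + \<Delta>p)\<rparr>"

definition add_node :: "real \<Rightarrow> real \<Rightarrow> real \<Rightarrow> network \<Rightarrow> network" where
  "add_node p_new q_in q_out N =
     (let m = Suc (num_nodes N) in
        \<lparr>num_nodes = m,
         ext_rate = (\<lambda>j. if j = m then p_new else ext_rate N j),
         int_rate = (\<lambda>i j. if j = m then q_in else if i = m then q_out else int_rate N i j)\<rparr>)"

end

theory Submission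
  imports Defs "HOL-Real_Asymp.Real_Asymp"
begin

text \<open>
  Take two nodes: in \<open>A\<close> they have external rate \<open>1\<close> and influence each other at rate \<open>3\<close>, in \<open>B\<close>
  they are isolated with external rate \<open>2\<close>. In both networks each node stays a nonadopter with a
  probability of order \<open>exp (-2t)\<close>, but in \<open>A\<close> the exponent comes from the probability that
  neither node has adopted, so it benefits twice from any additional external influence,
  whereas in \<open>B\<close> it benefits once: for \<open>\<Delta>p = 1\<close> the exponents become \<open>4\<close> and \<open>3\<close>. A
  new node that adopts fast and influences the two old nodes at rate \<open>1\<close> has the same effect.

  The probabilities that no node of a set \<open>K\<close> has adopted satisfy a closed linear system (the
  master equations), which follows from Kolmogorov's forward equation and is solved explicitly
  for these networks. Since \<^const>\<open>bass_measure\<close> is a Hilbert choice, the process must also be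
  shown to exist: its transition kernels are those of a discrete chain run by a Poisson clock
  (uniformization), and Kolmogorov's extension theorem yields the measure on path space.
\<close>

section \<open>Markov processes from transition semigroups\<close>

lemma sets_count_space_Collect:
  assumes "f \<in> measurable M (count_space E)"
  shows "{\<omega> \<in> space M. Q (f \<omega>)} \<in> sets M"
proof -
  have "f -` {y \<in> E. Q y} \<inter> space M = {\<omega> \<in> space M. Q (f \<omega>)}"
    using measurable_space[OF assms] by auto
  then show ?thesis
    using measurable_sets[OF assms, of "{y \<in> E. Q y}"] by simp
qed

locale markov_semigroup =
  fixes E :: "'s set" and P :: "real \<Rightarrow> 's \<Rightarrow> 's pmf"
  assumes countable_states: "countable E"
    and kernel_closed: "\<lbrakk>0 \<le> h; x \<in> E\<rbrakk> \<Longrightarrow> set_pmf (P h x) \<subseteq> E"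
    and kernel_0: "x \<in> E \<Longrightarrow> P 0 x = return_pmf x"
    and chapman_kolmogorov:
      "\<lbrakk>0 \<le> s; 0 \<le> t; x \<in> E\<rbrakk> \<Longrightarrow> bind_pmf (P s x) (P t) = P (s + t) x"
begin

section \<open>Laws of the states along an increasing list of times\<close>

text \<open>Law of the states at the listed times for a chain in \<open>x\<close> at time
  \<open>s\<close>. Outcomes are functions of time, \<open>undefined\<close> off the list, so laws
  for different lists share one type and can be compared after \<open>restrict\<close>.\<close>

primrec path_pmf :: "real list \<Rightarrow> real \<Rightarrow> 's \<Rightarrow> (real \<Rightarrow> 's) pmf" where
  "path_pmf [] s x = return_pmf (\<lambda>_. undefined)"
| "path_pmf (t # ts) s x =
     bind_pmf (P (t - s) x) (\<lambda>y. map_pmf (\<lambda>f. f(t := y)) (path_pmf ts t y))"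

lemma path_pmf_states:
  assumes "sorted (s # ts)" "x \<in> E" "f \<in> set_pmf (path_pmf ts s x)" "t \<in> set ts"
  shows "f t \<in> E"
  using assms
proof (induction ts arbitrary: s x f)
  case (Cons u ts)
  then obtain y g where "y \<in> set_pmf (P (u - s) x)" "g \<in> set_pmf (path_pmf ts u y)" "f = g(u := y)"
    by auto
  moreover have "y \<in> E"
    using calculation kernel_closed[of "u - s" x] Cons.prems by auto
  ultimately show ?case
    using Cons.IH[of u y g] Cons.prems by auto
qed auto

text \<open>By Chapman-Kolmogorov, an intermediate time whose state is not recorded leaves the law
  unchanged.\<close>

lemma path_pmf_skip:
  assumes "s \<le> t" "sorted (t # ts)" "x \<in> E"
  shows "bind_pmf (P (t - s) x) (path_pmf ts t) = path_pmf ts s x"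
proof (cases ts)
  case (Cons u us)
  then have "P (u - s) x = bind_pmf (P (t - s) x) (P (u - t))"
    using assms by (subst chapman_kolmogorov) auto
  then show ?thesis
    unfolding Cons path_pmf.simps by (simp add: bind_assoc_pmf)
next
  case Nil
  have "path_pmf [] t = (\<lambda>_. return_pmf (\<lambda>_. undefined))"
    by (rule ext) simp
  then show ?thesis
    unfolding Nil by simp
qed

text \<open>Consistency of the laws, as Kolmogorov's extension demands. A time in \<open>J\<close>
  is kept on both sides; a time outside \<open>J\<close> is erased by the restriction and then
  dropped by \<open>path_pmf_skip\<close>.\<close>

lemma path_pmf_filter:
  assumes "sorted (s # ts)" "x \<in> E"
  shows "map_pmf (\<lambda>f. restrict f J) (path_pmf ts s x) =
    map_pmf (\<lambda>f. restrict f J) (path_pmf (filter (\<lambda>t. t \<in> J) ts) s x)"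
  using assms
proof (induction ts arbitrary: s x)
  case (Cons t ts)
  let ?us = "filter (\<lambda>t. t \<in> J) ts"
  have IH: "map_pmf (\<lambda>f. restrict f J) (path_pmf ts t y) =
      map_pmf (\<lambda>f. restrict f J) (path_pmf ?us t y)" if "y \<in> set_pmf (P (t - s) x)" for y
  proof (rule Cons.IH)
    show "y \<in> E"
      using that Cons.prems kernel_closed[of "t - s" x] by auto
  qed (use Cons.prems in simp)
  show ?case
  proof (cases "t \<in> J")
    case True
    then have upd: "restrict (f(t := y)) J = (restrict f J)(t := y)" for f :: "real \<Rightarrow> 's" and y
      by auto
    have head: "map_pmf (\<lambda>f. restrict f J) (path_pmf (t # us) s x) = bind_pmf (P (t - s) x)
        (\<lambda>y. map_pmf (\<lambda>f. f(t := y)) (map_pmf (\<lambda>f. restrict f J) (path_pmf us t y)))" for us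
      by (simp only: path_pmf.simps map_bind_pmf map_pmf_comp upd)
    have "map_pmf (\<lambda>f. restrict f J) (path_pmf (t # ts) s x) =
        map_pmf (\<lambda>f. restrict f J) (path_pmf (t # ?us) s x)"
      unfolding head using IH by (intro bind_pmf_cong) simp_all
    then show ?thesis
      using True by (simp only: filter.simps if_True)
  next
    case False
    then have upd: "restrict (f(t := y)) J = restrict f J" for f :: "real \<Rightarrow> 's" and y
      by auto
    have "map_pmf (\<lambda>f. restrict f J) (path_pmf (t # ts) s x) =
        bind_pmf (P (t - s) x) (\<lambda>y. map_pmf (\<lambda>f. restrict f J) (path_pmf ?us t y))"
      by (auto simp: map_bind_pmf map_pmf_comp upd IH intro!: bind_pmf_cong)
    also have "\<dots> = map_pmf (\<lambda>f. restrict f J) (path_pmf ?us s x)"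
      using Cons.prems by (subst path_pmf_skip[of s t, symmetric]) (auto simp: map_bind_pmf sorted_wrt_filter)
    finally show ?thesis
      using False by (simp only: filter.simps if_False)
  qed
qed simp

lemma path_pmf_prob_Cons:
  assumes "t \<notin> set ts"
  shows "measure (path_pmf (t # ts) s x) {f. \<forall>u\<in>set (t # ts). f u = z u} =
    pmf (P (t - s) x) (z t) * measure (path_pmf ts t (z t)) {f. \<forall>u\<in>set ts. f u = z u}"
proof -
  let ?A = "{f. \<forall>u\<in>set ts. f u = z u}"
  have "emeasure (path_pmf ts t y) ((\<lambda>f. f(t := y)) -` {f. \<forall>u\<in>set (t # ts). f u = z u}) =
      emeasure (path_pmf ts t (z t)) ?A * indicator {z t} y" for y
  proof (cases "y = z t")
    case True
    with assms have "(\<lambda>f. f(t := y)) -` {f. \<forall>u\<in>set (t # ts). f u = z u} = ?A"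
      by auto
    with True show ?thesis by simp
  next
    case False
    then have "(\<lambda>f. f(t := y)) -` {f. \<forall>u\<in>set (t # ts). f u = z u} = {}"
      by auto
    with False show ?thesis by simp
  qed
  then have "emeasure (path_pmf (t # ts) s x) {f. \<forall>u\<in>set (t # ts). f u = z u} =
      (\<integral>\<^sup>+y. emeasure (path_pmf ts t (z t)) ?A * indicator {z t} y \<partial>P (t - s) x)"
    by simp
  also have "\<dots> = emeasure (path_pmf ts t (z t)) ?A * pmf (P (t - s) x) (z t)"
    by (simp add: nn_integral_cmult_indicator emeasure_pmf_single)
  finally show ?thesis
    by (simp add: measure_pmf.emeasure_eq_measure ennreal_mult'[symmetric] mult.commute)
qed

text \<open>The Markov property in product form. Laws unfold from the first time, so the induction
  strips the leading factors common to both sides until only the last transition is left.\<close>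

lemma path_pmf_prob_snoc:
  assumes "distinct (ts @ [u, v])"
  shows "measure (path_pmf (ts @ [u, v]) s x) {f. \<forall>t\<in>set (ts @ [u, v]). f t = z t} =
    measure (path_pmf (ts @ [u]) s x) {f. \<forall>t\<in>set (ts @ [u]). f t = z t} *
    pmf (P (v - u) (z u)) (z v)"
  using assms
proof (induction ts arbitrary: s x)
  case Nil
  then show ?case
    using path_pmf_prob_Cons[of u "[v]"] path_pmf_prob_Cons[of u "[]"] path_pmf_prob_Cons[of v "[]"]
    by (simp del: path_pmf.simps(2))
next
  case (Cons t ts)
  then show ?case
    using path_pmf_prob_Cons[of t "ts @ [u, v]" s x z] path_pmf_prob_Cons[of t "ts @ [u]" s x z]
    by (simp del: path_pmf.simps(2))
qed

text \<open>
  States are encoded as real numbers because Kolmogorov's extension theorem (\<^locale>\<open>polish_projective\<close>)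
  is available for Polish spaces only.
\<close>

definition fdd :: "'s \<Rightarrow> real set \<Rightarrow> (real \<Rightarrow> real) measure" where
  "fdd x J = distr (path_pmf (sorted_list_of_set J) 0 x) (\<Pi>\<^sub>M t\<in>J. borel)
     (\<lambda>f. \<lambda>t\<in>J. real (to_nat_on E (f t)))"

lemma fdd_restrict:
  assumes "x \<in> E" "J \<subseteq> H" "finite H" "H \<subseteq> {0..}"
  shows "fdd x J = distr (fdd x H) (\<Pi>\<^sub>M t\<in>J. borel) (\<lambda>f. restrict f J)"
proof -
  let ?enc = "\<lambda>f. \<lambda>t\<in>J. real (to_nat_on E (f t))"
  let ?M = "\<Pi>\<^sub>M t\<in>J. borel :: real measure"
  have ff: "filter (\<lambda>t. t \<in> J) (sorted_list_of_set H) = sorted_list_of_set J"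
    using assms finite_subset[OF assms(2,3)]
    by (intro sorted_distinct_set_unique) (auto intro: sorted_wrt_filter)
  have "distr (fdd x H) ?M (\<lambda>f. restrict f J) =
      distr (path_pmf (sorted_list_of_set H) 0 x) ?M ?enc"
    unfolding fdd_def using assms
    by (subst distr_distr) (auto intro!: distr_cong measurable_restrict_subset simp: comp_def fun_eq_iff space_PiM)
  also have "\<dots> = distr (map_pmf (\<lambda>f. restrict f J) (path_pmf (sorted_list_of_set H) 0 x)) ?M ?enc"
    unfolding map_pmf_rep_eq by (subst distr_distr) (auto intro!: distr_cong simp: comp_def fun_eq_iff space_PiM)
  also have "\<dots> = distr (map_pmf (\<lambda>f. restrict f J) (path_pmf (sorted_list_of_set J) 0 x)) ?M ?enc"
    using assms by (subst path_pmf_filter) (auto simp: ff)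
  also have "\<dots> = fdd x J"
    unfolding map_pmf_rep_eq fdd_def
    by (subst distr_distr) (auto intro!: distr_cong simp: comp_def fun_eq_iff space_PiM)
  finally show ?thesis ..
qed

section \<open>Path measure by Kolmogorov extension\<close>

text \<open>The projective limit of the coded laws lives on real-valued functions of nonnegative
  time. Decoding each coordinate gives a measure on state-valued paths, whose finite-dimensional
  events pull back to cylinder sets.\<close>

lemma path_measure_exists:
  assumes x: "x \<in> E"
  obtains \<Omega> :: "(real \<Rightarrow> 's) measure" where
    "prob_space \<Omega>"
    "\<And>t. (\<lambda>\<omega>. \<omega> t) \<in> measurable \<Omega> (count_space E)"
    "\<And>J z. \<lbrakk>finite J; J \<subseteq> {0..}\<rbrakk> \<Longrightarrow>
       \<P>(\<omega> in \<Omega>. \<forall>t\<in>J. \<omega> t = z t) =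
       measure (path_pmf (sorted_list_of_set J) 0 x) {f. \<forall>t\<in>J. f t = z t}"
proof -
  interpret polish_projective "{0..}" "fdd x"
  proof (intro polish_projective.intro projective_family.intro)
    show "fdd x J = distr (fdd x H) (\<Pi>\<^sub>M t\<in>J. borel) (\<lambda>f. restrict f J)"
      if "J \<subseteq> H" "finite H" "H \<subseteq> {0..}" for J H
      using fdd_restrict[OF x] that by blast
    show "prob_space (fdd x J)" if "finite J" "J \<subseteq> {0..}" for J
      unfolding fdd_def
      by (rule measure_pmf.prob_space_distr) (simp add: space_PiM)
  qed
  \<comment> \<open>Flooring makes the decoder total and measurable; \<open>E\<close> contains
    \<open>x\<close>, so every real number is decoded to some state in \<open>E\<close>.\<close>
  define dec where "dec a = from_nat_into E (nat \<lfloor>a\<rfloor>)" for a :: real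
  have dec_enc: "dec (real (to_nat_on E y)) = y" if "y \<in> E" for y
    using that countable_states by (simp add: dec_def)
  have dec_meas: "dec \<in> measurable borel (count_space E)"
    unfolding dec_def
    by (rule measurable_compose[OF measurable_real_floor])
       (use x in \<open>auto intro: from_nat_into\<close>)
  then have dec_E: "dec a \<in> E" for a
    by (auto dest: measurable_space)
  \<comment> \<open>Paths are indexed by all reals, the limit by nonnegative times only; negative
    times receive the default state \<open>x\<close>.\<close>
  define D where "D \<omega> t = (if 0 \<le> t then dec (\<omega> t) else x)" for \<omega> and t :: real
  let ?N = "\<Pi>\<^sub>M t\<in>UNIV. count_space E"
  have D_meas: "D \<in> measurable lim ?N"
  proof -
    have "(\<lambda>\<omega> t. D \<omega> t) \<in> measurable (\<Pi>\<^sub>M t\<in>{0..}. borel) ?N"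
    proof (rule measurable_PiM_single')
      show "(\<lambda>\<omega>. D \<omega> t) \<in> measurable (\<Pi>\<^sub>M t\<in>{0..}. borel) (count_space E)" for t
        using x dec_meas by (cases "0 \<le> t") (auto simp: D_def intro!: measurable_compose[OF _ dec_meas])
      show "(\<lambda>\<omega> t. D \<omega> t) \<in> space (\<Pi>\<^sub>M t\<in>{0..}. borel) \<rightarrow> (\<Pi>\<^sub>E t\<in>UNIV. space (count_space E))"
        using x dec_E by (auto simp: D_def)
    qed
    then show ?thesis
      by (simp cong: measurable_cong_sets)
  qed
  define \<Omega> where "\<Omega> = distr lim ?N D"
  show thesis
  proof (rule that[of \<Omega>])
    show "prob_space \<Omega>"
      unfolding \<Omega>_def by (rule P.prob_space_distr[OF D_meas])
    show *: "(\<lambda>\<omega>. \<omega> t) \<in> measurable \<Omega> (count_space E)" for t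
      unfolding \<Omega>_def by (simp cong: measurable_cong_sets)
    fix J :: "real set" and z
    assume J: "finite J" "J \<subseteq> {0..}"
    let ?X = "{g \<in> space (\<Pi>\<^sub>M t\<in>J. borel). \<forall>t\<in>J. dec (g t) = z t}"
    have X: "?X \<in> sets (\<Pi>\<^sub>M t\<in>J. borel)"
      using J by (intro sets.sets_Collect_finite_All sets_count_space_Collect[of _ _ E]
        measurable_compose[OF _ dec_meas] measurable_component_singleton)
    have "{\<omega> \<in> space \<Omega>. \<forall>t\<in>J. \<omega> t = z t} \<in> sets \<Omega>"
      using J * by (intro sets.sets_Collect_finite_All sets_count_space_Collect)
    then have "\<P>(\<omega> in \<Omega>. \<forall>t\<in>J. \<omega> t = z t) = measure lim (D -` {\<omega> \<in> space \<Omega>. \<forall>t\<in>J. \<omega> t = z t} \<inter> space lim)"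
      unfolding \<Omega>_def by (subst measure_distr[OF D_meas]) simp_all
    also have "D -` {\<omega> \<in> space \<Omega>. \<forall>t\<in>J. \<omega> t = z t} \<inter> space lim = emb {0..} J ?X"
      using J dec_E x
      by (auto simp: \<Omega>_def prod_emb_def space_PiM D_def PiE_iff subset_iff)
    also have "measure lim \<dots> = measure (fdd x J) ?X"
      using J X by (intro measure_lim_emb)
    also have "\<dots> = measure (path_pmf (sorted_list_of_set J) 0 x)
        {f. \<forall>t\<in>J. dec (real (to_nat_on E (f t))) = z t}"
      unfolding fdd_def using X
      by (subst measure_distr) (auto simp: space_PiM intro!: arg_cong[where f = "measure _"])
    \<comment> \<open>Coding is inverted by \<open>dec\<close> on \<open>E\<close>, where the
      recorded states lie almost surely by \<open>path_pmf_states\<close>.\<close>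
    also have "\<dots> = measure (path_pmf (sorted_list_of_set J) 0 x) {f. \<forall>t\<in>J. f t = z t}"
    proof (rule measure_pmf.finite_measure_eq_AE)
      have "f t \<in> E" if "f \<in> set_pmf (path_pmf (sorted_list_of_set J) 0 x)" "t \<in> J" for f t
        using that x J by (intro path_pmf_states[of 0 "sorted_list_of_set J"]) auto
      then show "AE f in path_pmf (sorted_list_of_set J) 0 x.
          (f \<in> {f. \<forall>t\<in>J. dec (real (to_nat_on E (f t))) = z t}) = (f \<in> {f. \<forall>t\<in>J. f t = z t})"
        by (auto simp: AE_measure_pmf_iff dec_enc)
    qed auto
    finally show "\<P>(\<omega> in \<Omega>. \<forall>t\<in>J. \<omega> t = z t) =
      measure (path_pmf (sorted_list_of_set J) 0 x) {f. \<forall>t\<in>J. f t = z t}" .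
  qed
qed

lemma markov_process_exists:
  assumes x: "x \<in> E"
  obtains \<Omega> :: "(real \<Rightarrow> 's) measure" where
    "prob_space \<Omega>"
    "\<And>t. (\<lambda>\<omega>. \<omega> t) \<in> measurable \<Omega> (count_space E)"
    "AE \<omega> in \<Omega>. \<omega> 0 = x"
    "\<And>n \<tau> (y :: nat \<Rightarrow> 's). \<lbrakk>0 \<le> \<tau> 0; \<forall>i\<le>n. \<tau> i < \<tau> (Suc i)\<rbrakk> \<Longrightarrow>
       \<P>(\<omega> in \<Omega>. \<forall>i\<le>Suc n. \<omega> (\<tau> i) = y i) =
       \<P>(\<omega> in \<Omega>. \<forall>i\<le>n. \<omega> (\<tau> i) = y i) * pmf (P (\<tau> (Suc n) - \<tau> n) (y n)) (y (Suc n))"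
proof -
  obtain \<Omega> :: "(real \<Rightarrow> 's) measure" where \<Omega>: "prob_space \<Omega>"
    "\<And>t. (\<lambda>\<omega>. \<omega> t) \<in> measurable \<Omega> (count_space E)"
    "\<And>J z. \<lbrakk>finite J; J \<subseteq> {0..}\<rbrakk> \<Longrightarrow>
       \<P>(\<omega> in \<Omega>. \<forall>t\<in>J. \<omega> t = z t) =
       measure (path_pmf (sorted_list_of_set J) 0 x) {f. \<forall>t\<in>J. f t = z t}"
    using path_measure_exists[OF x] by blast
  interpret prob_space \<Omega> by fact
  show thesis
  proof (rule that[OF \<Omega>(1,2)])
    show "AE \<omega> in \<Omega>. \<omega> 0 = x"
    proof (rule AE_I_eq_1)
      show "emeasure \<Omega> {\<omega> \<in> space \<Omega>. \<omega> 0 = x} = 1"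
        using \<Omega>(3)[of "{0}" "\<lambda>_. x"] x by (simp add: emeasure_eq_measure kernel_0 bind_return_pmf)
      \<comment> \<open>A set outside the sigma-algebra has \<open>emeasure\<close> 0, so the value
        1 just shown implies measurability.\<close>
      then show "{\<omega> \<in> space \<Omega>. \<omega> 0 = x} \<in> sets \<Omega>"
        by (metis emeasure_notin_sets zero_neq_one)
    qed
    fix n :: nat and \<tau> :: "nat \<Rightarrow> real" and y :: "nat \<Rightarrow> 's"
    assume \<tau>: "0 \<le> \<tau> 0" "\<forall>i\<le>n. \<tau> i < \<tau> (Suc i)"
    have less: "\<tau> i < \<tau> j" if "i < j" "j \<le> Suc n" for i j
      using that
    proof (induction j)
      case (Suc j)
      with \<tau>(2) show ?case
        by (cases "i = j") (auto intro: less_trans)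
    qed simp
    have inj: "inj_on \<tau> {..Suc n}"
      by (metis atMost_iff less inj_onI less_irrefl linorder_neqE_nat)
    have nonneg: "0 \<le> \<tau> i" if "i \<le> Suc n" for i
      using \<tau>(1) less[of 0 i] that by (cases "i = 0") auto
    \<comment> \<open>Prescribed states are re-indexed by time instead of position, which is
      possible because \<open>\<tau>\<close> is injective on these indices.\<close>
    define z where "z = y \<circ> the_inv_into {..Suc n} \<tau>"
    have z: "z (\<tau> i) = y i" if "i \<le> Suc n" for i
      using that inj by (simp add: z_def the_inv_into_f_f)
    have sort: "sorted_list_of_set (\<tau> ` {..m}) = map \<tau> [0..<Suc m]" if "m \<le> Suc n" for m
    proof (rule sorted_distinct_set_unique)
      show "sorted (map \<tau> [0..<Suc m])"
        using that less by (auto simp: sorted_iff_nth_mono_less simp del: upt_Suc intro!: less_imp_le)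
      show "distinct (map \<tau> [0..<Suc m])"
        using that by (auto simp: distinct_map simp del: upt_Suc intro: inj_on_subset[OF inj])
    qed (auto simp del: upt_Suc simp: atLeast0LessThan lessThan_Suc_atMost)
    have prob: "\<P>(\<omega> in \<Omega>. \<forall>i\<le>m. \<omega> (\<tau> i) = y i) =
        measure (path_pmf (map \<tau> [0..<Suc m]) 0 x) {f. \<forall>t\<in>set (map \<tau> [0..<Suc m]). f t = z t}"
      if "m \<le> Suc n" for m
    proof -
      have "\<P>(\<omega> in \<Omega>. \<forall>i\<le>m. \<omega> (\<tau> i) = y i) = \<P>(\<omega> in \<Omega>. \<forall>t\<in>\<tau> ` {..m}. \<omega> t = z t)"
        using that z by (intro arg_cong[where f = "measure _"]) auto
      also have "\<dots> = measure (path_pmf (map \<tau> [0..<Suc m]) 0 x) {f. \<forall>t\<in>\<tau> ` {..m}. f t = z t}"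
        using that nonneg by (subst \<Omega>(3)) (auto simp: sort simp del: upt_Suc)
      also have "\<tau> ` {..m} = set (map \<tau> [0..<Suc m])"
        by (auto simp del: upt_Suc simp: atLeast0LessThan lessThan_Suc_atMost)
      finally show ?thesis .
    qed
    have "distinct (map \<tau> [0..<n] @ [\<tau> n, \<tau> (Suc n)])"
      using inj_on_subset[OF inj, of "{..<Suc (Suc n)}"]
      by (auto simp: distinct_map inj_on_def) force+
    from path_pmf_prob_snoc[OF this, of 0 x z]
    show "\<P>(\<omega> in \<Omega>. \<forall>i\<le>Suc n. \<omega> (\<tau> i) = y i) =
        \<P>(\<omega> in \<Omega>. \<forall>i\<le>n. \<omega> (\<tau> i) = y i) * pmf (P (\<tau> (Suc n) - \<tau> n) (y n)) (y (Suc n))"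
      by (simp add: prob z)
  qed
qed

end

section \<open>Uniformization\<close>

text \<open>\<^const>\<open>poisson_pmf\<close> is only specified for positive rates.\<close>

definition poisson_count :: "real \<Rightarrow> nat pmf" where
  "poisson_count a = (if a = 0 then return_pmf 0 else poisson_pmf a)"

lemma pmf_poisson_count:
  "0 \<le> a \<Longrightarrow> pmf (poisson_count a) k = a ^ k / fact k * exp (- a)"
  by (cases k) (auto simp: poisson_count_def pmf_return)

text \<open>The convolution weight at \<open>k\<close> is a finite sum evaluated by the binomial
  theorem. This additivity over adjacent intervals yields Chapman-Kolmogorov below.\<close>

lemma poisson_count_add:
  assumes "0 \<le> a" "0 \<le> b"
  shows "poisson_count (a + b) =
    bind_pmf (poisson_count a) (\<lambda>m. map_pmf (\<lambda>n. m + n) (poisson_count b))"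
proof (rule pmf_eqI)
  fix k
  have shift: "pmf (map_pmf (\<lambda>n. m + n) (poisson_count b)) k =
      (if m \<le> k then pmf (poisson_count b) (k - m) else 0)" for m
  proof (cases "m \<le> k")
    case True
    then show ?thesis
      using pmf_map_inj'[of "\<lambda>n. m + n" "poisson_count b" "k - m"] by (simp add: inj_def)
  next
    case False
    then show ?thesis by (auto intro!: pmf_map_outside)
  qed
  have "pmf (bind_pmf (poisson_count a) (\<lambda>m. map_pmf (\<lambda>n. m + n) (poisson_count b))) k =
      (\<Sum>m\<le>k. (if m \<le> k then pmf (poisson_count b) (k - m) else 0) * pmf (poisson_count a) m)"
    unfolding pmf_bind shift by (rule integral_measure_pmf_real) (auto split: if_splits)
  also have "\<dots> = (\<Sum>m\<le>k. of_nat (k choose m) * a ^ m * b ^ (k - m)) * exp (- (a + b)) / fact k"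
    using assms unfolding sum_distrib_right sum_divide_distrib
    by (intro sum.cong) (auto simp: pmf_poisson_count binomial_fact exp_diff exp_minus field_simps exp_add)
  also have "\<dots> = pmf (poisson_count (a + b)) k"
    using assms by (simp add: pmf_poisson_count binomial_ring)
  finally show "pmf (poisson_count (a + b)) k =
      pmf (bind_pmf (poisson_count a) (\<lambda>m. map_pmf (\<lambda>n. m + n) (poisson_count b))) k" ..
qed

primrec chain_pmf :: "('s \<Rightarrow> 's pmf) \<Rightarrow> nat \<Rightarrow> 's \<Rightarrow> 's pmf" where
  "chain_pmf K 0 x = return_pmf x"
| "chain_pmf K (Suc n) x = bind_pmf (K x) (chain_pmf K n)"

lemma chain_pmf_add: "bind_pmf (chain_pmf K m x) (chain_pmf K n) = chain_pmf K (m + n) x"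
  by (induction m arbitrary: x) (simp_all add: bind_return_pmf bind_assoc_pmf)

lemma set_chain_pmf:
  assumes "\<And>x. x \<in> E \<Longrightarrow> set_pmf (K x) \<subseteq> E" "x \<in> E"
  shows "set_pmf (chain_pmf K n x) \<subseteq> E"
  using assms(2) by (induction n arbitrary: x) (use assms(1) in fastforce)+

text \<open>The chain that jumps according to \<open>K\<close> at the events of a Poisson clock with intensity \<open>rate\<close>.\<close>

definition uniformized :: "real \<Rightarrow> ('s \<Rightarrow> 's pmf) \<Rightarrow> real \<Rightarrow> 's \<Rightarrow> 's pmf" where
  "uniformized rate K h x = bind_pmf (poisson_count (rate * h)) (\<lambda>n. chain_pmf K n x)"

text \<open>Poisson counts and steps of the discrete chain both add up over adjacent intervals; the
  second count is independent of the first chain segment, so the order of these two draws may be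
  exchanged.\<close>

lemma markov_semigroup_uniformized:
  assumes "countable E" "\<And>x. x \<in> E \<Longrightarrow> set_pmf (K x) \<subseteq> E" "0 \<le> rate"
  shows "markov_semigroup E (uniformized rate K)"
proof
  show "set_pmf (uniformized rate K h x) \<subseteq> E" if "x \<in> E" for h x
    using set_chain_pmf[of E K] assms(2) that by (fastforce simp: uniformized_def)
  show "uniformized rate K 0 x = return_pmf x" for x
    by (simp add: uniformized_def poisson_count_def bind_return_pmf)
  fix s t :: real and x
  assume "0 \<le> s" "0 \<le> t"
  then have "uniformized rate K (s + t) x =
      bind_pmf (poisson_count (rate * s)) (\<lambda>m. bind_pmf (poisson_count (rate * t))
        (\<lambda>n. bind_pmf (chain_pmf K m x) (chain_pmf K n)))"
    using assms(3) by (simp add: uniformized_def ring_distribs poisson_count_add bind_assoc_pmf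
      bind_map_pmf chain_pmf_add)
  also have "\<dots> = bind_pmf (uniformized rate K s x) (uniformized rate K t)"
    unfolding uniformized_def bind_assoc_pmf
    by (subst (2) bind_commute_pmf) simp
  finally show "bind_pmf (uniformized rate K s x) (uniformized rate K t) = uniformized rate K (s + t) x" ..
qed fact

text \<open>Two or more events of the Poisson clock in time \<open>h\<close> have probability \<open>o(h)\<close>.\<close>

lemma uniformized_rate:
  assumes "0 < rate" "x \<noteq> y"
  shows "((\<lambda>h. pmf (uniformized rate K h x) y / h) \<longlongrightarrow> rate * pmf (K x) y) (at_right 0)"
proof (rule tendsto_sandwich)
  let ?q = "pmf (K x) y"
  let ?g = "\<lambda>n. pmf (chain_pmf K n x) y"
  have g1: "?g 1 = ?q"
  proof -
    have "chain_pmf K 0 = return_pmf"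
      by (rule ext) simp
    then show ?thesis
      by (simp add: bind_return_pmf')
  qed
  \<comment> \<open>By the number of events: none contributes 0 because \<open>x \<noteq> y\<close>,
    one contributes \<open>?q\<close> exactly, and more contribute a value between 0 and 1.\<close>
  have bounds: "rate * h * exp (- (rate * h)) * ?q \<le> pmf (uniformized rate K h x) y \<and>
      pmf (uniformized rate K h x) y \<le>
        rate * h * exp (- (rate * h)) * ?q + (1 - exp (- (rate * h)) - rate * h * exp (- (rate * h)))"
    if "0 < h" for h
  proof -
    let ?N = "poisson_count (rate * h)"
    have int: "integrable ?N (\<lambda>n. indicator {k} n :: real)" for k
      by (intro measure_pmf.integrable_const_bound[where B = 1]) (auto simp: indicator_def)
    have int_g: "integrable ?N ?g"
      by (intro measure_pmf.integrable_const_bound[where B = 1]) (auto simp: pmf_le_1)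
    have "(\<integral>n. ?q * indicator {1} n \<partial>?N) \<le> (\<integral>n. ?g n \<partial>?N)"
      using g1 by (intro integral_mono integrable_mult_right int int_g) (auto simp: indicator_def)
    moreover have "(\<integral>n. ?g n \<partial>?N) \<le>
        (\<integral>n. ?q * indicator {1} n + (1 - indicator {0} n - indicator {1} n) \<partial>?N)"
      using g1 assms
      by (intro integral_mono integrable_mult_right Bochner_Integration.integrable_add
          Bochner_Integration.integrable_diff int int_g)
        (auto simp: pmf_le_1 indicator_def pmf_return)
    moreover have "(\<integral>n. indicator {k} n \<partial>?N) = pmf ?N k" for k
      by (simp add: measure_pmf_single)
    ultimately show ?thesis
      using int that assms
      by (simp add: pmf_poisson_count uniformized_def pmf_bind measure_pmf_single mult.commute)
  qed
  show "\<forall>\<^sub>F h in at_right 0. rate * exp (- (rate * h)) * ?q \<le> pmf (uniformized rate K h x) y / h"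
    using bounds by (auto simp: eventually_at_right_field field_simps intro!: exI[of _ 1])
  show "\<forall>\<^sub>F h in at_right 0. pmf (uniformized rate K h x) y / h \<le>
      rate * exp (- (rate * h)) * ?q + (1 - exp (- (rate * h))) / h - rate * exp (- (rate * h))"
  proof (rule eventually_at_rightI[of 0 1])
    fix h :: real assume "h \<in> {0<..<1}"
    then have h: "0 < h" by simp
    have "pmf (uniformized rate K h x) y / h \<le> (rate * h * exp (- (rate * h)) * ?q +
        (1 - exp (- (rate * h)) - rate * h * exp (- (rate * h)))) / h"
      using bounds[OF h] h by (intro divide_right_mono) auto
    also have "\<dots> = rate * exp (- (rate * h)) * ?q + (1 - exp (- (rate * h))) / h - rate * exp (- (rate * h))"
      using h by (simp add: add_divide_distrib diff_divide_distrib)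
    finally show "pmf (uniformized rate K h x) y / h \<le>
        rate * exp (- (rate * h)) * ?q + (1 - exp (- (rate * h))) / h - rate * exp (- (rate * h))" .
  qed simp
  show "((\<lambda>h. rate * exp (- (rate * h)) * ?q) \<longlongrightarrow> rate * ?q) (at_right 0)"
    by real_asymp
  show "((\<lambda>h. rate * exp (- (rate * h)) * ?q + (1 - exp (- (rate * h))) / h - rate * exp (- (rate * h)))
      \<longlongrightarrow> rate * ?q) (at_right 0)"
    using assms by real_asymp
qed


section \<open>Existence of a finite chain with prescribed rates\<close>

text \<open>A clock at least as fast as every total exit rate turns rates into jump probabilities.
  The remaining mass becomes a jump of \<open>x\<close> to itself, and in
  \<open>uniformized_rate\<close> the intensity cancels the normalisation.\<close>

theorem ctmc_exists:
  assumes fin: "finite E" and x0: "x0 \<in> E"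
    and r: "\<And>x y. \<lbrakk>x \<in> E; y \<in> E; x \<noteq> y\<rbrakk> \<Longrightarrow> 0 \<le> r x y"
  obtains \<Omega> where "ctmc \<Omega> E r (\<lambda>t \<omega>. \<omega> t)" "AE \<omega> in \<Omega>. \<omega> 0 = x0"
proof -
  \<comment> \<open>The sum of all rates bounds each row; the added 1 keeps the intensity positive
    even when every rate vanishes.\<close>
  define rate where "rate = 1 + (\<Sum>x\<in>E. \<Sum>y\<in>E - {x}. r x y)"
  have row: "(\<Sum>y\<in>E - {x}. r x y) \<le> rate" if "x \<in> E" for x
  proof -
    have "(\<Sum>y\<in>E - {x}. r x y) \<le> (\<Sum>x\<in>E. \<Sum>y\<in>E - {x}. r x y)"
      using that fin r by (intro member_le_sum[of x E "\<lambda>x. \<Sum>y\<in>E - {x}. r x y"] sum_nonneg) auto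
    then show ?thesis by (simp add: rate_def)
  qed
  have rate: "0 < rate"
    using r by (auto simp: rate_def intro!: add_pos_nonneg sum_nonneg)
  define k where "k x y = (if y = x then 1 - (\<Sum>z\<in>E - {x}. r x z) / rate
    else if y \<in> E then r x y / rate else 0)" for x y
  have k_nonneg: "0 \<le> k x y" if "x \<in> E" for x y
    using that r rate row by (auto simp: k_def field_simps)
  have k_sum: "(\<Sum>y\<in>E. k x y) = 1" if "x \<in> E" for x
    using fin that by (simp add: sum.remove[of E x] k_def sum_divide_distrib)
  have pmf_k: "pmf (embed_pmf (k x)) y = k x y" if "x \<in> E" for x y
  proof (rule pmf_embed_pmf)
    show "0 \<le> k x z" for z
      using k_nonneg that .
    have "(\<integral>\<^sup>+z. ennreal (k x z) \<partial>count_space UNIV) = (\<Sum>z\<in>E. ennreal (k x z))"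
      using fin that by (intro nn_integral_count_space') (auto simp: k_def)
    then show "(\<integral>\<^sup>+z. ennreal (k x z) \<partial>count_space UNIV) = 1"
      using that k_nonneg k_sum by (simp add: sum_ennreal)
  qed
  define K where "K x = embed_pmf (k x)" for x
  have K_E: "set_pmf (K x) \<subseteq> E" if "x \<in> E" for x
    using that by (auto simp: set_pmf_iff K_def pmf_k k_def split: if_splits)
  interpret markov_semigroup E "uniformized rate K"
    using fin K_E rate by (intro markov_semigroup_uniformized) (auto intro: countable_finite)
  obtain \<Omega> :: "(real \<Rightarrow> 'a) measure" where \<Omega>: "prob_space \<Omega>"
    "\<And>t. (\<lambda>\<omega>. \<omega> t) \<in> measurable \<Omega> (count_space E)"
    "AE \<omega> in \<Omega>. \<omega> 0 = x0"
    "\<And>n \<tau> y. \<lbrakk>0 \<le> \<tau> 0; \<forall>i\<le>n. \<tau> i < \<tau> (Suc i)\<rbrakk> \<Longrightarrow>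
       \<P>(\<omega> in \<Omega>. \<forall>i\<le>Suc n. \<omega> (\<tau> i) = y i) =
       \<P>(\<omega> in \<Omega>. \<forall>i\<le>n. \<omega> (\<tau> i) = y i) *
         pmf (uniformized rate K (\<tau> (Suc n) - \<tau> n) (y n)) (y (Suc n))"
    using markov_process_exists[OF x0] by blast
  have "ctmc \<Omega> E r (\<lambda>t \<omega>. \<omega> t)"
    unfolding ctmc_def
  proof (intro conjI allI impI exI[of _ "uniformized rate K"] ballI)
    show "set_pmf (uniformized rate K h x) \<subseteq> E" if "0 < h" "x \<in> E" for h x
      using kernel_closed that by auto
    show "((\<lambda>h. pmf (uniformized rate K h x) y / h) \<longlongrightarrow> r x y) (at_right 0)"
      if "x \<in> E" "y \<in> E" "x \<noteq> y" for x y
      using uniformized_rate[OF rate \<open>x \<noteq> y\<close>, of K] that rate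
      by (simp add: K_def pmf_k k_def)
    fix n :: nat and \<tau> :: "nat \<Rightarrow> real" and x :: "nat \<Rightarrow> 'a"
    assume *: "0 \<le> \<tau> 0 \<and> (\<forall>i\<le>n. \<tau> i < \<tau> (Suc i)) \<and> (\<forall>i\<le>Suc n. x i \<in> E) \<and>
      0 < \<P>(\<omega> in \<Omega>. \<forall>i\<le>n. \<omega> (\<tau> i) = x i)"
    have "\<P>(\<omega> in \<Omega>. \<omega> (\<tau> (Suc n)) = x (Suc n) \<and> (\<forall>i\<le>n. \<omega> (\<tau> i) = x i)) =
        \<P>(\<omega> in \<Omega>. \<forall>i\<le>Suc n. \<omega> (\<tau> i) = x i)"
      by (intro arg_cong[where f = "measure \<Omega>"]) (auto simp: le_Suc_eq)
    then show "\<P>(\<omega> in \<Omega>. \<omega> (\<tau> (Suc n)) = x (Suc n) \<bar> \<forall>i\<le>n. \<omega> (\<tau> i) = x i) =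
        pmf (uniformized rate K (\<tau> (Suc n) - \<tau> n) (x n)) (x (Suc n))"
      using * \<Omega>(4)[of \<tau> n x] by (simp add: cond_prob_def)
  qed (use \<Omega> fin in auto)
  then show thesis
    using \<Omega>(3) that by blast
qed

section \<open>Kolmogorov's forward equation\<close>

text \<open>The case \<open>n = 0\<close> of the Markov property, multiplied out. Where the
  conditioning event has probability 0, both sides vanish.\<close>

lemma ctmc_joint:
  assumes "ctmc \<Omega> E r Y"
  obtains P where
    "\<And>h x. \<lbrakk>0 < h; x \<in> E\<rbrakk> \<Longrightarrow> set_pmf (P h x) \<subseteq> E"
    "\<And>x y. \<lbrakk>x \<in> E; y \<in> E; x \<noteq> y\<rbrakk> \<Longrightarrow> ((\<lambda>h. pmf (P h x) y / h) \<longlongrightarrow> r x y) (at_right 0)"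
    "\<And>s h x y. \<lbrakk>0 \<le> s; 0 < h; x \<in> E; y \<in> E\<rbrakk> \<Longrightarrow>
       \<P>(\<omega> in \<Omega>. Y s \<omega> = x \<and> Y (s + h) \<omega> = y) = \<P>(\<omega> in \<Omega>. Y s \<omega> = x) * pmf (P h x) y"
proof -
  from assms obtain P where P: "\<forall>h>0. \<forall>x\<in>E. set_pmf (P h x) \<subseteq> E"
    "\<forall>x\<in>E. \<forall>y\<in>E. x \<noteq> y \<longrightarrow> ((\<lambda>h. pmf (P h x) y / h) \<longlongrightarrow> r x y) (at_right 0)"
    and M: "\<forall>n \<tau> x. 0 \<le> \<tau> 0 \<and> (\<forall>i\<le>n. \<tau> i < \<tau> (Suc i)) \<and> (\<forall>i\<le>Suc n. x i \<in> E) \<and>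
        0 < \<P>(\<omega> in \<Omega>. \<forall>i\<le>n. Y (\<tau> i) \<omega> = x i) \<longrightarrow>
        \<P>(\<omega> in \<Omega>. Y (\<tau> (Suc n)) \<omega> = x (Suc n) \<bar> \<forall>i\<le>n. Y (\<tau> i) \<omega> = x i)
          = pmf (P (\<tau> (Suc n) - \<tau> n) (x n)) (x (Suc n))"
    unfolding ctmc_def by (elim conjE exE) (rule that)
  interpret prob_space \<Omega>
    using assms by (simp add: ctmc_def)
  have Y: "Y t \<in> measurable \<Omega> (count_space E)" if "0 \<le> t" for t
    using assms that by (simp add: ctmc_def)
  have "\<P>(\<omega> in \<Omega>. Y s \<omega> = x \<and> Y (s + h) \<omega> = y) = \<P>(\<omega> in \<Omega>. Y s \<omega> = x) * pmf (P h x) y"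
    if "0 \<le> s" "0 < h" "x \<in> E" "y \<in> E" for s h x y
  proof (cases "\<P>(\<omega> in \<Omega>. Y s \<omega> = x) = 0")
    case True
    have "\<P>(\<omega> in \<Omega>. Y s \<omega> = x \<and> Y (s + h) \<omega> = y) \<le> \<P>(\<omega> in \<Omega>. Y s \<omega> = x)"
      using that by (intro finite_measure_mono sets_count_space_Collect[OF Y]) auto
    with True show ?thesis
      by (simp add: measure_le_0_iff)
  next
    case False
    then have pos: "0 < \<P>(\<omega> in \<Omega>. Y s \<omega> = x)"
      by (simp add: zero_less_measure_iff)
    define \<tau> where "\<tau> i = (if i = 0 then s else s + h)" for i :: nat
    define z where "z i = (if i = 0 then x else y)" for i :: nat
    have "\<P>(\<omega> in \<Omega>. Y (s + h) \<omega> = y \<bar> Y s \<omega> = x) = pmf (P h x) y"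
      using M[rule_format, of \<tau> 0 z] that pos by (simp add: \<tau>_def z_def)
    with pos show ?thesis
      by (simp add: cond_prob_def field_simps conj_commute)
  qed
  then show thesis
    using P by (intro that[of P]) simp_all
qed

text \<open>The infinitesimal generator acting on an observable \<open>f\<close>; the differences
  \<open>f y - f x\<close> account for the diagonal of the rate matrix.\<close>

definition generator :: "'s set \<Rightarrow> ('s \<Rightarrow> 's \<Rightarrow> real) \<Rightarrow> ('s \<Rightarrow> real) \<Rightarrow> 's \<Rightarrow> real" where
  "generator E r f x = (\<Sum>y\<in>E - {x}. r x y * (f y - f x))"

lemma ctmc_expectation:
  assumes "ctmc \<Omega> E r Y" "0 \<le> t"
  shows "(\<integral>\<omega>. f (Y t \<omega>) \<partial>\<Omega>) = (\<Sum>x\<in>E. \<P>(\<omega> in \<Omega>. Y t \<omega> = x) * f x)"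
proof -
  interpret prob_space \<Omega>
    using assms by (simp add: ctmc_def)
  have Y: "Y t \<in> measurable \<Omega> (count_space E)" and fin: "finite E"
    using assms by (auto simp: ctmc_def)
  have "(\<integral>\<omega>. f (Y t \<omega>) \<partial>\<Omega>) =
      (\<integral>\<omega>. (\<Sum>x\<in>E. indicator {\<omega> \<in> space \<Omega>. Y t \<omega> = x} \<omega> * f x) \<partial>\<Omega>)"
  proof (rule Bochner_Integration.integral_cong)
    fix \<omega> assume "\<omega> \<in> space \<Omega>"
    with measurable_space[OF Y] fin
    show "f (Y t \<omega>) = (\<Sum>x\<in>E. indicator {\<omega> \<in> space \<Omega>. Y t \<omega> = x} \<omega> * f x)"
      by (simp add: indicator_def)
  qed simp
  also have "\<dots> = (\<Sum>x\<in>E. \<P>(\<omega> in \<Omega>. Y t \<omega> = x) * f x)"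
    using sets_count_space_Collect[OF Y]
    by (subst Bochner_Integration.integral_sum) (auto simp: less_top[symmetric])
  finally show ?thesis .
qed

text \<open>A difference quotient of the expectation averages an approximate generator
  \<open>g\<close> over the law at the earlier time. \<open>g\<close> tends to the generator, and
  continuity of the law follows from the same increment formula. At time 0 the derivative is
  one-sided.\<close>

theorem kolmogorov_forward:
  assumes Y: "ctmc \<Omega> E r Y" and t: "0 \<le> t"
  shows "((\<lambda>t. \<integral>\<omega>. f (Y t \<omega>) \<partial>\<Omega>) has_real_derivative
    (\<integral>\<omega>. generator E r f (Y t \<omega>) \<partial>\<Omega>)) (at t within {0..})"
proof -
  define p where "p t x = \<P>(\<omega> in \<Omega>. Y t \<omega> = x)" for t x
  define u where "u f t = (\<Sum>x\<in>E. p t x * f x)" for f :: "'b \<Rightarrow> real" and t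
  interpret prob_space \<Omega>
    using Y by (simp add: ctmc_def)
  have fin: "finite E" and meas: "\<And>t. 0 \<le> t \<Longrightarrow> Y t \<in> measurable \<Omega> (count_space E)"
    using Y by (auto simp: ctmc_def)
  obtain P where P: "\<And>h x. \<lbrakk>0 < h; x \<in> E\<rbrakk> \<Longrightarrow> set_pmf (P h x) \<subseteq> E"
    and rate: "\<And>x y. \<lbrakk>x \<in> E; y \<in> E; x \<noteq> y\<rbrakk> \<Longrightarrow> ((\<lambda>h. pmf (P h x) y / h) \<longlongrightarrow> r x y) (at_right 0)"
    and joint: "\<And>s h x y. \<lbrakk>0 \<le> s; 0 < h; x \<in> E; y \<in> E\<rbrakk> \<Longrightarrow>
       \<P>(\<omega> in \<Omega>. Y s \<omega> = x \<and> Y (s + h) \<omega> = y) = p s x * pmf (P h x) y"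
    unfolding p_def using ctmc_joint[OF Y] by blast
  have level: "{\<omega> \<in> space \<Omega>. Y t \<omega> = x} \<in> sets \<Omega>" if "0 \<le> t" for t x
    by (rule sets_count_space_Collect[OF meas[OF that]])
  have step: "p (s + h) y = (\<Sum>x\<in>E. p s x * pmf (P h x) y)" if "0 \<le> s" "0 < h" "y \<in> E" for s h y
  proof -
    let ?B = "\<lambda>x. {\<omega> \<in> space \<Omega>. Y s \<omega> = x \<and> Y (s + h) \<omega> = y}"
    have "?B x \<in> sets \<Omega>" for x
      using that by (intro sets.sets_Collect_conj level) auto
    then have "measure \<Omega> (\<Union>x\<in>E. ?B x) = (\<Sum>x\<in>E. measure \<Omega> (?B x))"
      using fin by (intro finite_measure_finite_Union) (auto simp: disjoint_family_on_def)
    moreover have "(\<Union>x\<in>E. ?B x) = {\<omega> \<in> space \<Omega>. Y (s + h) \<omega> = y}"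
      using measurable_space[OF meas[OF that(1)]] by auto
    ultimately have "p (s + h) y = (\<Sum>x\<in>E. measure \<Omega> (?B x))"
      by (simp add: p_def)
    then show ?thesis
      using that by (simp add: joint)
  qed
  define g where "g f h x = (\<Sum>y\<in>E - {x}. pmf (P h x) y / h * (f y - f x))" for f :: "'b \<Rightarrow> real" and h x
  have g: "((\<lambda>h. g f h x) \<longlongrightarrow> generator E r f x) (at_right 0)" if "x \<in> E" for f x
    unfolding g_def generator_def using that by (intro tendsto_intros rate) auto
  have incr: "u f (s + h) - u f s = h * (\<Sum>x\<in>E. p s x * g f h x)" if "0 \<le> s" "0 < h" for f s h
  proof -
    have inner: "(\<Sum>y\<in>E. pmf (P h x) y * f y) - f x = h * g f h x" if "x \<in> E" for x
    proof -
      have "(\<Sum>y\<in>E. pmf (P h x) y) = 1"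
        using P fin \<open>0 < h\<close> that by (intro sum_pmf_eq_1) auto
      then have "(\<Sum>y\<in>E. pmf (P h x) y * f y) - f x = (\<Sum>y\<in>E. pmf (P h x) y * (f y - f x))"
        by (simp add: right_diff_distrib sum_subtractf sum_distrib_right[symmetric])
      also have "\<dots> = (\<Sum>y\<in>E - {x}. pmf (P h x) y * (f y - f x))"
        using fin by (intro sum.mono_neutral_right) auto
      finally show ?thesis
        using \<open>0 < h\<close> by (simp add: g_def sum_distrib_left)
    qed
    have "u f (s + h) = (\<Sum>y\<in>E. \<Sum>x\<in>E. p s x * pmf (P h x) y * f y)"
      using that by (simp add: u_def step sum_distrib_right)
    also have "\<dots> = (\<Sum>x\<in>E. p s x * (\<Sum>y\<in>E. pmf (P h x) y * f y))"
      by (subst sum.swap) (simp add: sum_distrib_left mult.assoc)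
    finally have "u f (s + h) - u f s = (\<Sum>x\<in>E. p s x * ((\<Sum>y\<in>E. pmf (P h x) y * f y) - f x))"
      by (simp add: u_def right_diff_distrib sum_subtractf)
    then show ?thesis
      by (simp add: inner sum_distrib_left mult.left_commute)
  qed
  let ?F = "at t within {0..}"
  have F: "\<forall>\<^sub>F s in ?F. 0 \<le> s \<and> s \<noteq> t"
    by (auto simp: eventually_at_filter)
  have gap: "filterlim (\<lambda>s. \<bar>s - t\<bar>) (at_right 0) ?F"
    unfolding filterlim_at
  proof
    show "\<forall>\<^sub>F s in ?F. \<bar>s - t\<bar> \<in> {0<..} \<and> \<bar>s - t\<bar> \<noteq> 0"
      using F by eventually_elim simp
    have "((\<lambda>s. \<bar>s - t\<bar>) \<longlongrightarrow> \<bar>t - t\<bar>) ?F"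
      by (intro tendsto_intros)
    then show "((\<lambda>s. \<bar>s - t\<bar>) \<longlongrightarrow> 0) ?F"
      by simp
  qed
  \<comment> \<open>Taking \<open>min s t\<close> as base point covers the left and the right difference quotients at once.\<close>
  have diff: "u f s - u f t = (s - t) * (\<Sum>x\<in>E. p (min s t) x * g f \<bar>s - t\<bar> x)"
    if "0 \<le> s" "s \<noteq> t" for f s
  proof (cases "t < s")
    case True
    then show ?thesis using incr[of t "s - t" f] t by (simp add: min_def)
  next
    case False
    let ?S = "\<Sum>x\<in>E. p (min s t) x * g f \<bar>s - t\<bar> x"
    from False have "u f t - u f s = (t - s) * ?S"
      using incr[of s "t - s" f] that by (simp add: min_def)
    then show ?thesis by (simp add: left_diff_distrib)
  qed
  have p_bound: "\<bar>p s x\<bar> \<le> 1" for s x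
    by (simp add: p_def)
  have p_E: "p s x = u (\<lambda>y. of_bool (y = x)) s" if "x \<in> E" for s x
  proof -
    have "E \<inter> {y. y = x} = {x}"
      using that by auto
    then show ?thesis
      using fin by (simp add: u_def)
  qed
  have G: "((\<lambda>s. g f \<bar>s - t\<bar> x) \<longlongrightarrow> generator E r f x) ?F" if "x \<in> E" for f x
    using filterlim_compose[OF g[OF that] gap] .
  \<comment> \<open>Probabilities are at most 1, so an increment is bounded by
    \<open>\<bar>s - t\<bar>\<close> times a factor with a finite limit.\<close>
  have cont: "(u f \<longlongrightarrow> u f t) ?F" for f
  proof -
    have "((\<lambda>s. \<Sum>x\<in>E. \<bar>g f \<bar>s - t\<bar> x\<bar>) \<longlongrightarrow> (\<Sum>x\<in>E. \<bar>generator E r f x\<bar>)) ?F"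
      by (rule tendsto_sum) (rule tendsto_rabs[OF G])
    moreover have "((\<lambda>s. \<bar>s - t\<bar>) \<longlongrightarrow> 0) ?F"
      using gap by (simp add: filterlim_at)
    ultimately have lim: "((\<lambda>s. \<bar>s - t\<bar> * (\<Sum>x\<in>E. \<bar>g f \<bar>s - t\<bar> x\<bar>)) \<longlongrightarrow> 0) ?F"
      by (rule tendsto_mult[of _ "0 :: real", simplified, rotated])
    have "\<forall>\<^sub>F s in ?F. norm (u f s - u f t) \<le> \<bar>s - t\<bar> * (\<Sum>x\<in>E. \<bar>g f \<bar>s - t\<bar> x\<bar>)"
      using F
    proof eventually_elim
      case (elim s)
      have "norm (\<Sum>x\<in>E. p (min s t) x * g f \<bar>s - t\<bar> x) \<le> (\<Sum>x\<in>E. \<bar>g f \<bar>s - t\<bar> x\<bar>)"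
        using p_bound by (intro sum_norm_le) (simp add: abs_mult mult_left_le_one_le)
      then show ?case
        using diff[of s f] elim by (simp add: abs_mult mult_left_mono)
    qed
    from Lim_null_comparison[OF this lim] show ?thesis
      by (rule LIM_zero_cancel)
  qed
  \<comment> \<open>\<open>min s t\<close> is either \<open>s\<close>, where \<open>cont\<close>
    applies to the indicator of \<open>x\<close>, or \<open>t\<close>, where the distance is
    0.\<close>
  have p_min: "((\<lambda>s. p (min s t) x) \<longlongrightarrow> p t x) ?F" if "x \<in> E" for x
    unfolding p_E[OF that]
  proof (rule tendstoI)
    fix e :: real assume "0 < e"
    from tendstoD[OF cont this]
    show "\<forall>\<^sub>F s in ?F. dist (u (\<lambda>y. of_bool (y = x)) (min s t)) (u (\<lambda>y. of_bool (y = x)) t) < e"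
      by eventually_elim (use \<open>0 < e\<close> in \<open>auto simp: min_def\<close>)
  qed
  have lim: "((\<lambda>s. \<Sum>x\<in>E. p (min s t) x * g f \<bar>s - t\<bar> x) \<longlongrightarrow> u (generator E r f) t) ?F"
    unfolding u_def by (rule tendsto_sum) (rule tendsto_mult[OF p_min G])
  have "((\<lambda>s. (u f s - u f t) / (s - t)) \<longlongrightarrow> u (generator E r f) t) ?F"
  proof (rule Lim_transform_eventually[OF lim])
    show "\<forall>\<^sub>F s in ?F. (\<Sum>x\<in>E. p (min s t) x * g f \<bar>s - t\<bar> x) = (u f s - u f t) / (s - t)"
      using F by eventually_elim (simp add: diff)
  qed
  then have deriv: "(u f has_real_derivative u (generator E r f) t) ?F"
    by (simp add: has_field_derivative_iff)
  have u: "(\<integral>\<omega>. f (Y s \<omega>) \<partial>\<Omega>) = u f s" if "0 \<le> s" for f :: "'b \<Rightarrow> real" and s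
    unfolding u_def p_def by (rule ctmc_expectation[OF Y that])
  show ?thesis
    unfolding u[OF t, of "generator E r f"]
  proof (rule has_field_derivative_transform_within[OF deriv zero_less_one])
    show "u f s = (\<integral>\<omega>. f (Y s \<omega>) \<partial>\<Omega>)" if "s \<in> {0..}" for s
      using u[of s f] that by simp
  qed (use t in simp)
qed

section \<open>Master equations of the Bass model\<close>

lemma finite_nodes [simp]: "finite (nodes N)"
  by (simp add: nodes_def)

lemma adoption_rate_nonneg:
  assumes "valid_network N" "j \<in> nodes N"
  shows "0 \<le> adoption_rate N j S"
  using assms by (auto simp: valid_network_def adoption_rate_def intro!: add_nonneg_nonneg sum_nonneg)

text \<open>Exhibiting one suitable measure suffices, as \<open>bass_measure\<close> is a Hilbert
  choice.\<close>

lemma bass_process_bass_measure: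
  assumes "valid_network N"
  shows "bass_process N (bass_measure N) (\<lambda>t \<omega>. \<omega> t)"
proof -
  have "0 \<le> transition_rate N S T" for S T
    unfolding transition_rate_def using adoption_rate_nonneg[OF assms] by (intro sum_nonneg) auto
  then obtain \<Omega> where "ctmc \<Omega> (Pow (nodes N)) (transition_rate N) (\<lambda>t \<omega>. \<omega> t)"
    "AE \<omega> in \<Omega>. \<omega> 0 = {}"
    using ctmc_exists[of "Pow (nodes N)" "{}" "transition_rate N"] by auto
  then have "bass_process N \<Omega> (\<lambda>t \<omega>. \<omega> t)"
    by (simp add: bass_process_def)
  then show ?thesis
    unfolding bass_measure_def by (rule someI)
qed

text \<open>Each transition adds one nonadopter \<open>j\<close>, and \<open>insert j S\<close>
  differs from \<open>S\<close>, so the sum over targets collapses to one over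
  \<open>j\<close>.\<close>

lemma bass_generator:
  assumes "S \<subseteq> nodes N"
  shows "generator (Pow (nodes N)) (transition_rate N) f S =
    (\<Sum>j\<in>nodes N - S. adoption_rate N j S * (f (insert j S) - f S))"
proof -
  let ?E = "Pow (nodes N) - {S}"
  have "generator (Pow (nodes N)) (transition_rate N) f S =
      (\<Sum>T\<in>?E. \<Sum>j\<in>nodes N - S.
        if T = insert j S then adoption_rate N j S * (f T - f S) else 0)"
    unfolding generator_def transition_rate_def sum_distrib_right
    by (intro sum.cong) auto
  also have "\<dots> = (\<Sum>j\<in>nodes N - S. \<Sum>T\<in>?E.
        if T = insert j S then adoption_rate N j S * (f T - f S) else 0)"
    by (rule sum.swap)
  also have "\<dots> = (\<Sum>j\<in>nodes N - S. adoption_rate N j S * (f (insert j S) - f S))"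
  proof (rule sum.cong)
    fix j assume "j \<in> nodes N - S"
    with assms have "insert j S \<in> ?E" by auto
    then show "(\<Sum>T\<in>?E. if T = insert j S then adoption_rate N j S * (f T - f S) else 0) =
        adoption_rate N j S * (f (insert j S) - f S)"
      by (simp add: sum.delta)
  qed simp
  finally show ?thesis .
qed

section \<open>Closed linear system for the nonadoption probabilities\<close>

text \<open>The product of \<open>1 - X j\<close> over \<open>K\<close>. The generator sends it to a
  linear combination of such products for \<open>K\<close> and larger sets, which is why the
  equations close.\<close>

definition nonadopted :: "nat set \<Rightarrow> nat set \<Rightarrow> real" where
  "nonadopted K S = of_bool (S \<inter> K = {})"

lemma nonadopted_insert: "nonadopted (insert k K) S = (1 - of_bool (k \<in> S)) * nonadopted K S"
  by (simp add: nonadopted_def)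

text \<open>The indicator changes only when a node of \<open>K\<close> adopts, at a rate affine in
  the states. The product of the state of \<open>k\<close> with the indicator equals
  \<open>nonadopted K S - nonadopted (insert k K) S\<close>, which removes the nonlinearity.\<close>

lemma generator_nonadopted:
  assumes "K \<subseteq> nodes N" "S \<subseteq> nodes N"
  shows "generator (Pow (nodes N)) (transition_rate N) (nonadopted K) S =
    (\<Sum>j\<in>K. \<Sum>k\<in>nodes N - {j}. int_rate N k j * nonadopted (insert k K) S) -
    (\<Sum>j\<in>K. ext_rate N j + (\<Sum>k\<in>nodes N - {j}. int_rate N k j)) * nonadopted K S"
proof -
  have "generator (Pow (nodes N)) (transition_rate N) (nonadopted K) S =
      (\<Sum>j\<in>nodes N - S. if j \<in> K then - (adoption_rate N j S * nonadopted K S) else 0)"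
    unfolding bass_generator[OF assms(2)] by (intro sum.cong) (auto simp: nonadopted_def)
  also have "\<dots> = - (\<Sum>j\<in>(nodes N - S) \<inter> K. adoption_rate N j S) * nonadopted K S"
    by (simp add: sum.inter_restrict[symmetric] sum_negf sum_distrib_right)
  \<comment> \<open>If \<open>S\<close> meets \<open>K\<close>, the indicator is 0 and kills both
    sides; otherwise all of \<open>K\<close> are nonadopters.\<close>
  also have "\<dots> = - (\<Sum>j\<in>K. adoption_rate N j S) * nonadopted K S"
  proof (cases "S \<inter> K = {}")
    case True
    then have "(nodes N - S) \<inter> K = K" using assms by auto
    then show ?thesis by simp
  qed (simp add: nonadopted_def)
  also have "\<dots> = (\<Sum>j\<in>K. (\<Sum>k\<in>nodes N - {j}. int_rate N k j * nonadopted (insert k K) S) -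
      (ext_rate N j + (\<Sum>k\<in>nodes N - {j}. int_rate N k j)) * nonadopted K S)"
    unfolding sum_distrib_right sum_negf[symmetric]
  proof (rule sum.cong)
    fix j
    have "(\<Sum>k\<in>nodes N - {j}. int_rate N k j * nonadopted (insert k K) S) =
        (\<Sum>k\<in>nodes N - {j}. int_rate N k j) * nonadopted K S -
        (\<Sum>k\<in>nodes N - {j}. int_rate N k j * of_bool (k \<in> S)) * nonadopted K S"
      unfolding sum_distrib_right sum_subtractf[symmetric] nonadopted_insert
      by (rule sum.cong) (simp_all add: left_diff_distrib right_diff_distrib)
    then show "- adoption_rate N j S * nonadopted K S =
        (\<Sum>k\<in>nodes N - {j}. int_rate N k j * nonadopted (insert k K) S) -
        (ext_rate N j + (\<Sum>k\<in>nodes N - {j}. int_rate N k j)) * nonadopted K S"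
      unfolding adoption_rate_def by (simp only: ring_distribs mult_minus_left)
  qed simp
  finally show ?thesis
    by (simp add: sum_subtractf sum_distrib_right)
qed

definition nonadoption_prob :: "network \<Rightarrow> nat set \<Rightarrow> real \<Rightarrow> real" where
  "nonadoption_prob N K t = (\<integral>\<omega>. nonadopted K (\<omega> t) \<partial>bass_measure N)"

lemma nonadoption_prob_0:
  assumes "valid_network N"
  shows "nonadoption_prob N K 0 = 1"
proof -
  note N = bass_process_bass_measure[OF assms, unfolded bass_process_def]
  interpret prob_space "bass_measure N"
    using N by (simp add: ctmc_def)
  have "(\<lambda>\<omega>. \<omega> 0) \<in> measurable (bass_measure N) (count_space (Pow (nodes N)))"
    using N by (simp add: ctmc_def)
  then have [measurable]: "(\<lambda>\<omega>. nonadopted K (\<omega> 0)) \<in> borel_measurable (bass_measure N)"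
    by (rule measurable_compose) simp
  have "nonadoption_prob N K 0 = (\<integral>\<omega>. 1 \<partial>bass_measure N)"
    unfolding nonadoption_prob_def
  proof (rule integral_cong_AE)
    show "AE \<omega> in bass_measure N. nonadopted K (\<omega> 0) = 1"
      using N by (auto simp: nonadopted_def)
  qed simp_all
  then show ?thesis
    by (simp add: prob_space)
qed

text \<open>The forward equation for the observable \<open>nonadopted K\<close>. Only
  \<open>K\<close> and its supersets occur, so the system can be solved from the full node set
  downwards; terms with \<open>k \<in> K\<close> cancel between gain and loss.\<close>

theorem master_equation:
  assumes "valid_network N" "K \<subseteq> nodes N" "0 \<le> t"
  shows "(nonadoption_prob N K has_real_derivative
    (\<Sum>j\<in>K. \<Sum>k\<in>nodes N - {j}. int_rate N k j * nonadoption_prob N (insert k K) t) -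
    (\<Sum>j\<in>K. ext_rate N j + (\<Sum>k\<in>nodes N - {j}. int_rate N k j)) * nonadoption_prob N K t)
    (at t within {0..})"
proof -
  let ?E = "Pow (nodes N)"
  let ?p = "\<lambda>S. \<P>(\<omega> in bass_measure N. \<omega> t = S)"
  have N: "ctmc (bass_measure N) ?E (transition_rate N) (\<lambda>t \<omega>. \<omega> t)"
    using bass_process_bass_measure[OF assms(1)] by (simp add: bass_process_def)
  note expectation = ctmc_expectation[OF N assms(3)]
  let ?c = "\<Sum>j\<in>K. ext_rate N j + (\<Sum>k\<in>nodes N - {j}. int_rate N k j)"
  have "(\<integral>\<omega>. generator ?E (transition_rate N) (nonadopted K) (\<omega> t) \<partial>bass_measure N) =
      (\<Sum>S\<in>?E. ?p S * ((\<Sum>j\<in>K. \<Sum>k\<in>nodes N - {j}. int_rate N k j * nonadopted (insert k K) S) -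
        ?c * nonadopted K S))"
    unfolding expectation[of "generator ?E (transition_rate N) (nonadopted K)"]
    using assms(2) by (intro sum.cong) (auto simp: generator_nonadopted)
  also have "\<dots> = (\<Sum>S\<in>?E. \<Sum>j\<in>K. \<Sum>k\<in>nodes N - {j}. int_rate N k j * (?p S * nonadopted (insert k K) S)) -
      ?c * (\<Sum>S\<in>?E. ?p S * nonadopted K S)"
    by (simp only: right_diff_distrib sum_subtractf sum_distrib_left mult.left_commute)
  also have "(\<Sum>S\<in>?E. \<Sum>j\<in>K. \<Sum>k\<in>nodes N - {j}. int_rate N k j * (?p S * nonadopted (insert k K) S)) =
      (\<Sum>j\<in>K. \<Sum>k\<in>nodes N - {j}. \<Sum>S\<in>?E. int_rate N k j * (?p S * nonadopted (insert k K) S))"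
    by (subst sum.swap, rule sum.cong[OF refl], subst sum.swap, rule refl)
  finally have "(\<integral>\<omega>. generator ?E (transition_rate N) (nonadopted K) (\<omega> t) \<partial>bass_measure N) =
      (\<Sum>j\<in>K. \<Sum>k\<in>nodes N - {j}. int_rate N k j * nonadoption_prob N (insert k K) t) -
      ?c * nonadoption_prob N K t"
    by (simp add: nonadoption_prob_def expectation[of "nonadopted _"] sum_distrib_left)
  with kolmogorov_forward[OF N assms(3), of "nonadopted K"] show ?thesis
    by (simp add: nonadoption_prob_def[abs_def])
qed

lemma adopter_fraction_eq:
  assumes "valid_network N" "0 \<le> t"
  shows "adopter_fraction N t =
    1 - (\<Sum>j\<in>nodes N. nonadoption_prob N {j} t) / real (num_nodes N)"
proof -
  let ?E = "Pow (nodes N)"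
  let ?p = "\<lambda>S. \<P>(\<omega> in bass_measure N. \<omega> t = S)"
  have N: "ctmc (bass_measure N) ?E (transition_rate N) (\<lambda>t \<omega>. \<omega> t)"
    using bass_process_bass_measure[OF assms(1)] by (simp add: bass_process_def)
  interpret prob_space "bass_measure N"
    using N by (simp add: ctmc_def)
  have total: "(\<Sum>S\<in>?E. ?p S) = 1"
    using ctmc_expectation[OF N assms(2), of "\<lambda>_. 1"] by (simp add: prob_space)
  have "(\<integral>\<omega>. (\<Sum>j\<in>nodes N. X j t \<omega>) \<partial>bass_measure N) =
      (\<Sum>S\<in>?E. ?p S * (\<Sum>j\<in>nodes N. of_bool (j \<in> S)))"
    unfolding X_def by (rule ctmc_expectation[OF N assms(2), of "\<lambda>S. \<Sum>j\<in>nodes N. of_bool (j \<in> S)"])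
  also have "\<dots> = (\<Sum>S\<in>?E. \<Sum>j\<in>nodes N. ?p S - ?p S * nonadopted {j} S)"
    unfolding sum_distrib_left by (intro sum.cong) (auto simp: nonadopted_def)
  also have "\<dots> = (\<Sum>j\<in>nodes N. 1 - nonadoption_prob N {j} t)"
    by (subst sum.swap) (simp add: sum_subtractf total nonadoption_prob_def
        ctmc_expectation[OF N assms(2), of "nonadopted _"])
  also have "\<dots> = real (num_nodes N) - (\<Sum>j\<in>nodes N. nonadoption_prob N {j} t)"
    by (simp add: sum_subtractf nodes_def)
  finally show ?thesis
    using assms(1) by (simp add: adopter_fraction_def valid_network_def diff_divide_distrib)
qed

text \<open>The common source \<open>g\<close> cancels in the difference, and the integrating factor
  \<open>exp (a * t)\<close> makes the product constant.\<close>

lemma linear_ode_unique: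
  fixes x y g :: "real \<Rightarrow> real"
  assumes x: "\<And>t. 0 \<le> t \<Longrightarrow> (x has_real_derivative g t - a * x t) (at t within {0..})"
    and y: "\<And>t. 0 \<le> t \<Longrightarrow> (y has_real_derivative g t - a * y t) (at t within {0..})"
    and init: "x 0 = y 0" and t: "0 \<le> t"
  shows "x t = y t"
proof -
  let ?z = "\<lambda>t. (x t - y t) * exp (a * t)"
  have deriv: "(?z has_real_derivative 0) (at s within {0..})" if "s \<in> {0..}" for s
    using that by (auto intro!: derivative_eq_intros x y simp: algebra_simps)
  have "?z t = ?z 0"
  proof -
    obtain c where "\<And>s. s \<in> {0..} \<Longrightarrow> ?z s = c"
      using has_field_derivative_zero_constant[OF _ deriv] by (metis convex_real_interval(1))
    from this[of t] this[of 0] show ?thesis using t by simp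
  qed
  then show ?thesis
    using init by simp
qed

section \<open>The two networks\<close>

text \<open>
  \<open>complete_pair 1 3\<close> and \<open>complete_pair 2 0\<close> play the roles of \<open>A\<close> and \<open>B\<close>. The node joined to
  them has \<open>p = 4\<close>, \<open>q\<^sup>i\<^sup>n = 0\<close> and \<open>q\<^sup>o\<^sup>u\<^sup>t = 1\<close>, which keeps all exponents below distinct.
\<close>

definition complete_pair :: "real \<Rightarrow> real \<Rightarrow> network" where
  "complete_pair p q = \<lparr>num_nodes = 2, ext_rate = (\<lambda>_. p), int_rate = (\<lambda>_ _. q)\<rparr>"

definition joined_pair :: "real \<Rightarrow> real \<Rightarrow> network" where
  "joined_pair p q = add_node 4 0 1 (complete_pair p q)"

lemma pair_simps [simp]:
  "num_nodes (complete_pair p q) = 2"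
  "nodes (complete_pair p q) = {1, 2}"
  "ext_rate (complete_pair p q) = (\<lambda>_. p)"
  "int_rate (complete_pair p q) = (\<lambda>_ _. q)"
  "raise_external d (complete_pair p q) = complete_pair (p + d) q"
  by (auto simp: complete_pair_def nodes_def raise_external_def)

lemma joined_pair_simps [simp]:
  "num_nodes (joined_pair p q) = 3"
  "nodes (joined_pair p q) = {1, 2, 3}"
  "ext_rate (joined_pair p q) = (\<lambda>j. if j = 3 then 4 else p)"
  "int_rate (joined_pair p q) = (\<lambda>i j. if j = 3 then 0 else if i = 3 then 1 else q)"
  by (auto simp: joined_pair_def add_node_def Let_def nodes_def fun_eq_iff complete_pair_def)

lemma valid_pairs:
  assumes "0 \<le> p" "0 \<le> q"
  shows "valid_network (complete_pair p q)" "valid_network (joined_pair p q)"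
  using assms by (auto simp: valid_network_def)

lemma pair_Diff:
  "{Suc 0, 2} - {Suc 0} = {2}" "{Suc 0, 2} - {2} = {Suc 0}"
  "{Suc 0, 2, 3} - {Suc 0} = {2, 3}" "{Suc 0, 2, 3} - {2} = {Suc 0, 3}"
  "{Suc 0, 2, 3} - {3} = {Suc 0, 2}"
  by auto

text \<open>Links \<open>master_equation\<close> to explicit solutions: known probabilities of
  larger sets enter the source \<open>g\<close>, and \<open>a\<close> is the net decay rate after
  cancellation.\<close>

lemma nonadoption_unique:
  assumes N: "valid_network N" "K \<subseteq> nodes N" "0 \<le> t"
    and deriv: "\<And>t. 0 \<le> t \<Longrightarrow> (\<Sum>j\<in>K. \<Sum>k\<in>nodes N - {j}. int_rate N k j * nonadoption_prob N (insert k K) t) -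
      (\<Sum>j\<in>K. ext_rate N j + (\<Sum>k\<in>nodes N - {j}. int_rate N k j)) * nonadoption_prob N K t =
      g t - a * nonadoption_prob N K t"
    and y: "\<And>t. (y has_real_derivative g t - a * y t) (at t)" "y 0 = 1"
  shows "nonadoption_prob N K t = y t"
proof (rule linear_ode_unique[where x = "nonadoption_prob N K" and y = y and g = g and a = a])
  show "(nonadoption_prob N K has_real_derivative g t - a * nonadoption_prob N K t) (at t within {0..})"
    if "0 \<le> t" for t
    using master_equation[OF N(1,2) that] deriv[OF that] by simp
  show "(y has_real_derivative g t - a * y t) (at t within {0..})" for t
    using y(1) by (rule has_field_derivative_at_within)
qed (use nonadoption_prob_0[OF N(1)] y N in auto)

section \<open>Explicit solutions for two nodes\<close>

text \<open>Without an adopter in the pair there is no internal influence, so only the two external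
  rates act.\<close>

lemma pair_both:
  assumes "0 \<le> p" "0 \<le> q" "0 \<le> t"
  shows "nonadoption_prob (complete_pair p q) {1, 2} t = exp (- (2 * p * t))"
  using assms
  by (intro nonadoption_unique[where g = "\<lambda>_. 0" and a = "2 * p"])
    (auto intro!: derivative_eq_intros valid_pairs
      simp: pair_Diff insert_commute insert_absorb algebra_simps)

text \<open>The source is \<open>q\<close> times \<open>pair_both\<close>, the decay
  \<open>p + q\<close>. Since \<open>p \<noteq> q\<close>, the source exponent \<open>2 * p\<close>
  differs from the decay rate.\<close>

lemma pair_single:
  assumes pq: "0 \<le> p" "0 \<le> q" "p \<noteq> q" and t: "0 \<le> t" and j: "j \<in> {1, 2}"
  shows "nonadoption_prob (complete_pair p q) {j} t =
    (q * exp (- (2 * p * t)) - p * exp (- ((p + q) * t))) / (q - p)"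
  using t
proof (rule nonadoption_unique[rotated 2,
    where g = "\<lambda>t. q * exp (- (2 * p * t))" and a = "p + q"])
  show "((\<lambda>t. (q * exp (- (2 * p * t)) - p * exp (- ((p + q) * t))) / (q - p))
      has_real_derivative q * exp (- (2 * p * t)) -
        (p + q) * ((q * exp (- (2 * p * t)) - p * exp (- ((p + q) * t))) / (q - p))) (at t)" for t
    using pq(3) by (auto intro!: derivative_eq_intros simp: divide_simps) (simp add: algebra_simps)
qed (use j pq pair_both[OF pq(1,2), simplified] in
    \<open>auto simp: valid_pairs pair_Diff insert_commute\<close>)

section \<open>Explicit solutions after joining a third node\<close>

lemma joined_pair_new:
  assumes "0 \<le> p" "0 \<le> q" "0 \<le> t"
  shows "nonadoption_prob (joined_pair p q) {3} t = exp (- (4 * t))"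
  using assms
  by (intro nonadoption_unique[where g = "\<lambda>_. 0" and a = 4])
    (auto intro!: derivative_eq_intros valid_pairs
      simp: pair_Diff insert_commute insert_absorb algebra_simps)

lemma joined_pair_all:
  assumes "0 \<le> p" "0 \<le> q" "0 \<le> t"
  shows "nonadoption_prob (joined_pair p q) {1, 2, 3} t = exp (- ((2 * p + 4) * t))"
  using assms
  by (intro nonadoption_unique[where g = "\<lambda>_. 0" and a = "2 * p + 4"])
    (auto intro!: derivative_eq_intros valid_pairs
      simp: pair_Diff insert_commute insert_absorb algebra_simps)

text \<open>The new node influences each old node at rate 1, hence the decay
  \<open>2 * p + 2\<close> and a source of twice \<open>joined_pair_all\<close>.\<close>

lemma joined_pair_old:
  assumes pq: "0 \<le> p" "0 \<le> q" and t: "0 \<le> t"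
  shows "nonadoption_prob (joined_pair p q) {1, 2} t =
    2 * exp (- ((2 * p + 2) * t)) - exp (- ((2 * p + 4) * t))"
  using t
proof (rule nonadoption_unique[rotated 2,
    where g = "\<lambda>t. 2 * exp (- ((2 * p + 4) * t))" and a = "2 * p + 2"])
  show "((\<lambda>t. 2 * exp (- ((2 * p + 2) * t)) - exp (- ((2 * p + 4) * t)))
      has_real_derivative 2 * exp (- ((2 * p + 4) * t)) -
        (2 * p + 2) * (2 * exp (- ((2 * p + 2) * t)) - exp (- ((2 * p + 4) * t)))) (at t)" for t
    by (auto intro!: derivative_eq_intros simp: algebra_simps)
qed (use pq joined_pair_all[OF pq, simplified] in
    \<open>auto simp: valid_pairs pair_Diff insert_commute insert_absorb algebra_simps\<close>)

text \<open>Until it adopts, the new node has no influence, so the solution is that of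
  \<open>pair_single\<close> times \<open>exp (- (4 * t))\<close>.\<close>

lemma joined_pair_mixed:
  assumes pq: "0 \<le> p" "0 \<le> q" "p \<noteq> q" and t: "0 \<le> t" and j: "j \<in> {1, 2}"
  shows "nonadoption_prob (joined_pair p q) {j, 3} t =
    (q * exp (- ((2 * p + 4) * t)) - p * exp (- ((p + q + 4) * t))) / (q - p)"
  using t
proof (rule nonadoption_unique[rotated 2,
    where g = "\<lambda>t. q * exp (- ((2 * p + 4) * t))" and a = "p + q + 4"])
  show "((\<lambda>t. (q * exp (- ((2 * p + 4) * t)) - p * exp (- ((p + q + 4) * t))) / (q - p))
      has_real_derivative q * exp (- ((2 * p + 4) * t)) - (p + q + 4) *
        ((q * exp (- ((2 * p + 4) * t)) - p * exp (- ((p + q + 4) * t))) / (q - p))) (at t)" for t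
    using pq(3) by (auto intro!: derivative_eq_intros simp: divide_simps) (simp add: algebra_simps)
qed (use j pq joined_pair_all[OF pq(1,2), simplified] in
    \<open>auto simp: valid_pairs pair_Diff insert_commute insert_absorb algebra_simps\<close>)

text \<open>Decay \<open>1 + 3 + 1\<close> from the external rate, the partner and the new node;
  source \<open>3\<close> times \<open>joined_pair_old\<close> plus
  \<open>joined_pair_mixed\<close>. A source term \<open>c * exp (- (b * t))\<close> contributes the
  coefficient \<open>c / (5 - b)\<close>, and the initial value 1 fixes
  \<open>- 20 / 3\<close>.\<close>

lemma joined_coupled_single:
  assumes t: "0 \<le> t" and j: "j \<in> {1, 2}"
  shows "nonadoption_prob (joined_pair 1 3) {j} t =
    6 * exp (- (4 * t)) - 20 / 3 * exp (- (5 * t)) + 3 / 2 * exp (- (6 * t)) + 1 / 6 * exp (- (8 * t))"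
    (is "_ = ?y t")
proof -
  have mixed: "nonadoption_prob (joined_pair 1 3) {j, 3} t =
      3 / 2 * exp (- (6 * t)) - 1 / 2 * exp (- (8 * t))" if "0 \<le> t" for t
    using joined_pair_mixed[of 1 3 t j] that j by simp
  show ?thesis
    using t
  proof (rule nonadoption_unique[rotated 2, where y = ?y and a = 5 and
      g = "\<lambda>t. 6 * exp (- (4 * t)) - 3 / 2 * exp (- (6 * t)) - 1 / 2 * exp (- (8 * t))"])
    show "(?y has_real_derivative 6 * exp (- (4 * t)) - 3 / 2 * exp (- (6 * t)) -
        1 / 2 * exp (- (8 * t)) - 5 * ?y t) (at t)" for t
      by (auto intro!: derivative_eq_intros)
  qed (use j joined_pair_old[of 1 3, simplified] mixed in
      \<open>auto simp: valid_pairs pair_Diff insert_commute insert_absorb\<close>)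
qed

text \<open>Only the new node exerts influence: decay \<open>2 + 1\<close>, and
  \<open>joined_pair_mixed\<close> as source, which is \<open>exp (- (6 * t))\<close> here.\<close>

lemma joined_isolated_single:
  assumes t: "0 \<le> t" and j: "j \<in> {1, 2}"
  shows "nonadoption_prob (joined_pair 2 0) {j} t =
    4 / 3 * exp (- (3 * t)) - 1 / 3 * exp (- (6 * t))" (is "_ = ?y t")
  using t
proof (rule nonadoption_unique[rotated 2, where y = ?y and a = 3 and g = "\<lambda>t. exp (- (6 * t))"])
  show "(?y has_real_derivative exp (- (6 * t)) - 3 * ?y t) (at t)" for t
    by (auto intro!: derivative_eq_intros)
qed (use j joined_pair_mixed[of 2 0 _ "Suc 0", simplified] joined_pair_mixed[of 2 0 _ 2, simplified] in
    \<open>auto simp: valid_pairs pair_Diff insert_commute insert_absorb\<close>)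

section \<open>Comparison of the two networks\<close>

lemma adopter_fraction_pair:
  assumes "0 \<le> p" "0 \<le> q" "p \<noteq> q" "0 \<le> t"
  shows "adopter_fraction (complete_pair p q) t =
    1 - (q * exp (- (2 * p * t)) - p * exp (- ((p + q) * t))) / (q - p)"
proof -
  let ?y = "(q * exp (- (2 * p * t)) - p * exp (- ((p + q) * t))) / (q - p)"
  have "adopter_fraction (complete_pair p q) t = 1 - (?y + ?y) / 2"
    using assms pair_single[OF assms(1-4), of 1] pair_single[OF assms(1-4), of 2]
    by (simp only: adopter_fraction_eq valid_pairs) simp
  also have "(?y + ?y) / 2 = ?y"
    by (rule field_sum_of_halves[unfolded add_divide_distrib[symmetric]])
  finally show ?thesis .
qed

theorem lemma10:
  "\<exists>A B :: network.
     valid_network A \<and> valid_network B \<and> num_nodes A = num_nodes B \<and>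
     (\<forall>t>0. adopter_fraction A t < adopter_fraction B t) \<and>
     (\<exists>\<Delta>p\<ge>0. \<forall>\<^sub>F t in at_top.
        adopter_fraction (raise_external \<Delta>p A) t > adopter_fraction (raise_external \<Delta>p B) t) \<and>
     (\<exists>p_new\<ge>0. \<exists>q_in\<ge>0. \<exists>q_out\<ge>0. \<forall>\<^sub>F t in at_top.
        adopter_fraction (add_node p_new q_in q_out A) t
          > adopter_fraction (add_node p_new q_in q_out B) t)"
proof (rule exI[of _ "complete_pair 1 3"], rule exI[of _ "complete_pair 2 0"], intro conjI)
  \<comment> \<open>The nonadoption probabilities are
    \<open>(3 * exp (- (2 * t)) - exp (- (4 * t))) / 2\<close> and \<open>exp (- (2 * t))\<close>,
    so the claim amounts to \<open>exp (- (4 * t)) < exp (- (2 * t))\<close>.\<close>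
  show "\<forall>t>0. adopter_fraction (complete_pair 1 3) t < adopter_fraction (complete_pair 2 0) t"
    by (simp add: adopter_fraction_pair)
  \<comment> \<open>With \<open>\<Delta>p = 1\<close> the slowest decay rates become 4 for the
    coupled pair and 3 for the isolated one.\<close>
  have "\<forall>\<^sub>F t in at_top. 3 * exp (- (4 * t)) - 2 * exp (- (5 * t)) < exp (- (3 * t :: real))"
    by real_asymp
  then have "\<forall>\<^sub>F t in at_top. adopter_fraction (raise_external 1 (complete_pair 1 3)) t >
      adopter_fraction (raise_external 1 (complete_pair 2 0)) t"
    using eventually_ge_at_top[of 0] by eventually_elim (simp add: adopter_fraction_pair)
  then show "\<exists>\<Delta>p\<ge>0. \<forall>\<^sub>F t in at_top. adopter_fraction (raise_external \<Delta>p (complete_pair 1 3)) t >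
      adopter_fraction (raise_external \<Delta>p (complete_pair 2 0)) t"
    by (intro exI[of _ 1]) simp
  have "\<forall>\<^sub>F t :: real in at_top. 6 * exp (- (4 * t)) - 20 / 3 * exp (- (5 * t)) +
      3 / 2 * exp (- (6 * t)) + 1 / 6 * exp (- (8 * t)) < 4 / 3 * exp (- (3 * t)) - 1 / 3 * exp (- (6 * t))"
    by real_asymp
  \<comment> \<open>The new node has the same nonadoption probability in both networks, so the old
    nodes decide the comparison.\<close>
  then have "\<forall>\<^sub>F t in at_top. adopter_fraction (joined_pair 1 3) t > adopter_fraction (joined_pair 2 0) t"
    using eventually_ge_at_top[of 0]
  proof eventually_elim
    case (elim t)
    then show ?case
      using joined_coupled_single[of t 1] joined_coupled_single[of t 2]
        joined_isolated_single[of t 1] joined_isolated_single[of t 2]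
      by (simp add: adopter_fraction_eq valid_pairs joined_pair_new divide_right_mono)
  qed
  then show "\<exists>p_new\<ge>0. \<exists>q_in\<ge>0. \<exists>q_out\<ge>0. \<forall>\<^sub>F t in at_top.
      adopter_fraction (add_node p_new q_in q_out (complete_pair 1 3)) t >
      adopter_fraction (add_node p_new q_in q_out (complete_pair 2 0)) t"
    unfolding joined_pair_def
    by (rule_tac exI[of _ 4], rule_tac conjI[OF _ exI[of _ 0]], simp,
      rule_tac conjI[OF _ exI[of _ 1]], simp, simp)
qed (simp_all add: valid_pairs)

end
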